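(* Let $E$, $E_1$, $E_2$ be f-BCs with $E_1$ connected, let $f_1:E_1\rightarrow E$ be a morphism of f-BCs and let $f_2:E_2\rightarrow E$ be a covering of f-BCs. For $e_i\in E_i$ ($i=1,2$) with $f_1(e_1)=f_2(e_2)$, there exists a morphism $\phi:E_1\rightarrow E_2$ of f-BCs such that $f_1=f_2\phi$ and $\phi(e_1)=e_2$ if and only if $f_{1*}(\Pi(E_1,e_1))\subseteq f_{2*}(\Pi(E_2,e_2))$. Moreover, such $\phi$ is unique if it exists.
   Context: Let $G=\langle g\rangle$ be a fixed infinite cyclic group. A fractional Brauer configuration (f-BC) is a quadruple $E=(E,P,L,d)$, where $E$ is a $G$-set, $P$ and $L$ are two partitions of $E$ (write $P(e)$, $L(e)$ for the classes containing $e\in E$), and $d:E\to\mathbb{Z}_{>0}$ is a function, such that: (f1) $L(e)\subseteq P(e)$ and $P(e)$ is a finite set for each $e\in E$; (f2) if $L(e_1)=L(e_2)$, then $P(g\cdot e_1)=P(g\cdot e_2)$; (f3) if $e_1,e_2$ belong to the same $G$-orbit, then $d(e_1)=d(e_2)$; (f4) $P(e_1)=P(e_2)$ if and only if $P(g^{d(e_1)}\cdot e_1)=P(g^{d(e_2)}\cdot e_2)$; (f5) $L(e_1)=L(e_2)$ if and only if $L(g^{d(e_1)}\cdot e_1)=L(g^{d(e_2)}\cdot e_2)$; (f6) the sequence $L(g^{d(e)-1}\cdot e)\cdots L(g\cdot e)L(e)$ is not a proper subsequence (block of consecutive terms) of $L(g^{d(h)-1}\cdot h)\cdots L(g\cdot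 h)L(h)$ for all $e,h\in E$. Elements of $E$ are called angles and the sets $P(e)$ polygons. A morphism of f-BCs $f:(E,P,L,d)\to(E',P',L',d')$ is a $G$-equivariant map with $f(P(e))\subseteq P'(f(e))$, $f(L(e))\subseteq L'(f(e))$ and $d'(f(e))=d(e)$ for all $e\in E$. It is a covering if moreover $f$ induces bijections $P(e)\to P'(f(e))$ and $L(e)\to L'(f(e))$ for all $e\in E$. A walk of $E$ is a sequence $w=(e_n|\delta_n|e_{n-1})\cdots(e_2|\delta_2|e_1)(e_1|\delta_1|e_0)$ with $e_i\in E$, $\delta_i\in\{g,g^{-1},\tau\}$, such that $e_i=g\cdot e_{i-1}$ if $\delta_i=g$, $e_i=g^{-1}\cdot e_{i-1}$ if $\delta_i=g^{-1}$, and $P(e_i)=P(e_{i-1})$ if $\delta_i=\tau$. It is abbreviated $(e_n|\delta_n\cdots\delta_1|e_0)$; its source is $s(w)=e_0$, its terminal $t(w)=e_n$; $(e||e)$ is the walk of length $0$ at $e$. The composition $uv$ is defined by concatenation when $t(v)=s(u)$. $E$ is connected if any two angles can be connected by a walk. The homotopy relation $\sim$ is the smallest equivalence relation on walks such that: (h1) $(e|g^{-1}g|e)\sim(e|gg^{-1}|e)\sim(e|\tau|e)\sim(e||e)$; (h2) $(e_2|\tau|e_1)(e_1|\tau|e_0)\sim(e_2|\tau|e_0)$; (h3) $(g^{d(h)}\cdot h|\tau|g^{d(e)}\cdot e)(g^{d(e)}\cdot e|g^{d(e)}|e)\sim(g^{d(h)}\cdot h|g^{d(h)}|h)(h|\tau|e)$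 whenever $P(e)=P(h)$; (h4) $(g\cdot h|\tau|g\cdot e)(g\cdot e|g|e)\sim(g\cdot h|g|h)(h|\tau|e)$ whenever $L(e)=L(h)$; (h5) if $w_1\sim w_2$ then $uw_1\sim uw_2$ and $w_1v\sim w_2v$ whenever the compositions make sense. $\overline{w}$ denotes the homotopy class of $w$. The fundamental group $\Pi(E,e)$ is the group of homotopy classes of closed walks of $E$ at $e$ under composition. A morphism $f:E\to E'$ maps walks to walks (applying $f$ to all angles, keeping the $\delta_i$), preserves homotopy, and induces a group homomorphism $f_*:\Pi(E,e)\to\Pi(E',f(e))$. *)

theory Defs
  imports
    "HOL-Algebra.Group_Action"
    "HOL-Algebra.Generated_Groups"
    "HOL-Library.Sublist"
    "HOL-Library.Disjoint_Sets"
begin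

section \<open>Fractional Brauer configurations\<close>

locale infinite_cyclic_group = group G for G (structure) +
  fixes g
  assumes gen_closed: "g \<in> carrier G"
    and generates: "generate G {g} = carrier G"
    and infinite_carrier: "infinite (carrier G)"

record ('g, 'a) fbc_data =
  angles :: "'a set"
  act :: "'g \<Rightarrow> 'a \<Rightarrow> 'a"
  polygons :: "'a set set"
  lines :: "'a set set"
  deg :: "'a \<Rightarrow> nat"

definition block_of :: "'a set set \<Rightarrow> 'a \<Rightarrow> 'a set"
  where "block_of Q e = (THE X. X \<in> Q \<and> e \<in> X)"

abbreviation Pcl :: "('g, 'a) fbc_data \<Rightarrow> 'a \<Rightarrow> 'a set"
  where "Pcl E \<equiv> block_of (polygons E)"

abbreviation Lcl :: "('g, 'a) fbc_data \<Rightarrow> 'a \<Rightarrow> 'a set"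
  where "Lcl E \<equiv> block_of (lines E)"

abbreviation pow_act :: "('g, 'm) monoid_scheme \<Rightarrow> 'g \<Rightarrow> ('g, 'a) fbc_data \<Rightarrow> nat \<Rightarrow> 'a \<Rightarrow> 'a"
  where "pow_act G g E n e \<equiv> act E (g [^]\<^bsub>G\<^esub> n) e"

definition Lseq :: "('g, 'm) monoid_scheme \<Rightarrow> 'g \<Rightarrow> ('g, 'a) fbc_data \<Rightarrow> 'a \<Rightarrow> 'a set list"
  where "Lseq G g E e = map (\<lambda>i. Lcl E (pow_act G g E i e)) (rev [0..<deg E e])"

locale fractional_BC =
  infinite_cyclic_group G g + group_action G "angles E" "act E"
  for G (structure) and g and E :: "('g, 'a) fbc_data" +
  assumes partition_polygons: "partition_on (angles E) (polygons E)"
    and partition_lines: "partition_on (angles E) (lines E)"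
    and deg_pos: "e \<in> angles E \<Longrightarrow> deg E e > 0"
    and f1: "e \<in> angles E \<Longrightarrow> Lcl E e \<subseteq> Pcl E e \<and> finite (Pcl E e)"
    and f2: "\<lbrakk>e1 \<in> angles E; e2 \<in> angles E; Lcl E e1 = Lcl E e2\<rbrakk>
      \<Longrightarrow> Pcl E (act E g e1) = Pcl E (act E g e2)"
    and f3: "\<lbrakk>e1 \<in> angles E; e2 \<in> orbit G (act E) e1\<rbrakk> \<Longrightarrow> deg E e1 = deg E e2"
    and f4: "\<lbrakk>e1 \<in> angles E; e2 \<in> angles E\<rbrakk> \<Longrightarrow> Pcl E e1 = Pcl E e2 \<longleftrightarrow>
      Pcl E (pow_act G g E (deg E e1) e1) = Pcl E (pow_act G g E (deg E e2) e2)"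
    and f5: "\<lbrakk>e1 \<in> angles E; e2 \<in> angles E\<rbrakk> \<Longrightarrow> Lcl E e1 = Lcl E e2 \<longleftrightarrow>
      Lcl E (pow_act G g E (deg E e1) e1) = Lcl E (pow_act G g E (deg E e2) e2)"
    \<comment> \<open>sublists are blocks of consecutive terms\<close>
    and f6: "\<lbrakk>e \<in> angles E; h \<in> angles E\<rbrakk> \<Longrightarrow> \<not> strict_sublist (Lseq G g E e) (Lseq G g E h)"

text \<open>Maps between angle sets are total functions whose values outside the
  angle set are irrelevant; equality of morphisms is equality on the angles.\<close>

definition fbc_morphism ::
  "('g, 'm) monoid_scheme \<Rightarrow> ('g, 'a) fbc_data \<Rightarrow> ('g, 'b) fbc_data \<Rightarrow> ('a \<Rightarrow> 'b) \<Rightarrow> bool"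
  where "fbc_morphism G E E' f \<longleftrightarrow>
    f \<in> angles E \<rightarrow> angles E' \<and>
    (\<forall>x \<in> carrier G. \<forall>e \<in> angles E. f (act E x e) = act E' x (f e)) \<and>
    (\<forall>e \<in> angles E. f ` Pcl E e \<subseteq> Pcl E' (f e) \<and> f ` Lcl E e \<subseteq> Lcl E' (f e)
      \<and> deg E' (f e) = deg E e)"

definition fbc_covering ::
  "('g, 'm) monoid_scheme \<Rightarrow> ('g, 'a) fbc_data \<Rightarrow> ('g, 'b) fbc_data \<Rightarrow> ('a \<Rightarrow> 'b) \<Rightarrow> bool"
  where "fbc_covering G E E' f \<longleftrightarrow> fbc_morphism G E E' f \<and>
    (\<forall>e \<in> angles E. bij_betw f (Pcl E e) (Pcl E' (f e)) \<and> bij_betw f (Lcl E e) (Lcl E' (f e)))"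

section \<open>Walks and homotopy\<close>

datatype step = Fwd | Bwd | Tau

text \<open>\<open>Step e \<delta> w\<close> is the walk $(e|\delta|t(w))\,w$.\<close>

datatype 'a walk = Trivial 'a | Step 'a step "'a walk"

primrec source :: "'a walk \<Rightarrow> 'a" where
  "source (Trivial e) = e"
| "source (Step e \<delta> w) = source w"

primrec terminal :: "'a walk \<Rightarrow> 'a" where
  "terminal (Trivial e) = e"
| "terminal (Step e \<delta> w) = e"

text \<open>The composition \<open>u \<cdot> v\<close>, in which \<open>v\<close> is run first, is only meaningful
  when \<open>terminal v = source u\<close>.\<close>

primrec walk_comp :: "'a walk \<Rightarrow> 'a walk \<Rightarrow> 'a walk" (infixr "\<cdot>" 70) where
  "Trivial e \<cdot> v = v"
| "Step e \<delta> u \<cdot> v = Step e \<delta> (u \<cdot> v)"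

fun valid_step ::
  "('g, 'm) monoid_scheme \<Rightarrow> 'g \<Rightarrow> ('g, 'a) fbc_data \<Rightarrow> 'a \<Rightarrow> step \<Rightarrow> 'a \<Rightarrow> bool" where
  "valid_step G g E e' Fwd e \<longleftrightarrow> e' = act E g e"
| "valid_step G g E e' Bwd e \<longleftrightarrow> e' = act E (inv\<^bsub>G\<^esub> g) e"
| "valid_step G g E e' Tau e \<longleftrightarrow> Pcl E e' = Pcl E e"

primrec is_walk :: "('g, 'm) monoid_scheme \<Rightarrow> 'g \<Rightarrow> ('g, 'a) fbc_data \<Rightarrow> 'a walk \<Rightarrow> bool" where
  "is_walk G g E (Trivial e) \<longleftrightarrow> e \<in> angles E"
| "is_walk G g E (Step e \<delta> w) \<longleftrightarrow>
    e \<in> angles E \<and> is_walk G g E w \<and> valid_step G g E e \<delta> (terminal w)"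

definition fbc_connected ::
  "('g, 'm) monoid_scheme \<Rightarrow> 'g \<Rightarrow> ('g, 'a) fbc_data \<Rightarrow> bool"
  where "fbc_connected G g E \<longleftrightarrow>
    (\<forall>e \<in> angles E. \<forall>h \<in> angles E. \<exists>w. is_walk G g E w \<and> source w = e \<and> terminal w = h)"

text \<open>The walk $(g^n \cdot e \,|\, g^n \,|\, e)$ consisting of \<open>n\<close> single steps.\<close>

primrec pow_walk ::
  "('g, 'm) monoid_scheme \<Rightarrow> 'g \<Rightarrow> ('g, 'a) fbc_data \<Rightarrow> nat \<Rightarrow> 'a \<Rightarrow> 'a walk" where
  "pow_walk G g E 0 e = Trivial e"
| "pow_walk G g E (Suc n) e = Step (pow_act G g E (Suc n) e) Fwd (pow_walk G g E n e)"

inductive homotopic ::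
  "('g, 'm) monoid_scheme \<Rightarrow> 'g \<Rightarrow> ('g, 'a) fbc_data \<Rightarrow> 'a walk \<Rightarrow> 'a walk \<Rightarrow> bool"
  for G :: "('g, 'm) monoid_scheme" and g :: 'g and E :: "('g, 'a) fbc_data"
where
  refl: "is_walk G g E w \<Longrightarrow> homotopic G g E w w"
| sym: "homotopic G g E w1 w2 \<Longrightarrow> homotopic G g E w2 w1"
| trans: "\<lbrakk>homotopic G g E w1 w2; homotopic G g E w2 w3\<rbrakk> \<Longrightarrow> homotopic G g E w1 w3"
| h1_Bwd_Fwd: "e \<in> angles E
    \<Longrightarrow> homotopic G g E (Step e Bwd (Step (act E g e) Fwd (Trivial e))) (Trivial e)"
| h1_Fwd_Bwd: "e \<in> angles E
    \<Longrightarrow> homotopic G g E (Step e Fwd (Step (act E (inv\<^bsub>G\<^esub> g) e) Bwd (Trivial e))) (Trivial e)"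
| h1_Tau: "e \<in> angles E \<Longrightarrow> homotopic G g E (Step e Tau (Trivial e)) (Trivial e)"
| h2: "\<lbrakk>e0 \<in> angles E; e1 \<in> angles E; e2 \<in> angles E; Pcl E e1 = Pcl E e0; Pcl E e2 = Pcl E e1\<rbrakk>
    \<Longrightarrow> homotopic G g E (Step e2 Tau (Step e1 Tau (Trivial e0))) (Step e2 Tau (Trivial e0))"
| h3: "\<lbrakk>e \<in> angles E; h \<in> angles E; Pcl E e = Pcl E h\<rbrakk>
    \<Longrightarrow> homotopic G g E
      (Step (pow_act G g E (deg E h) h) Tau (pow_walk G g E (deg E e) e))
      (pow_walk G g E (deg E h) h \<cdot> Step h Tau (Trivial e))"
| h4: "\<lbrakk>e \<in> angles E; h \<in> angles E; Lcl E e = Lcl E h\<rbrakk>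
    \<Longrightarrow> homotopic G g E
      (Step (act E g h) Tau (Step (act E g e) Fwd (Trivial e)))
      (Step (act E g h) Fwd (Step h Tau (Trivial e)))"
| h5_left: "\<lbrakk>homotopic G g E w1 w2; is_walk G g E u; terminal w1 = source u; terminal w2 = source u\<rbrakk>
    \<Longrightarrow> homotopic G g E (u \<cdot> w1) (u \<cdot> w2)"
| h5_right: "\<lbrakk>homotopic G g E w1 w2; is_walk G g E v; terminal v = source w1; terminal v = source w2\<rbrakk>
    \<Longrightarrow> homotopic G g E (w1 \<cdot> v) (w2 \<cdot> v)"

definition homotopy_class ::
  "('g, 'm) monoid_scheme \<Rightarrow> 'g \<Rightarrow> ('g, 'a) fbc_data \<Rightarrow> 'a walk \<Rightarrow> 'a walk set"
  where "homotopy_class G g E w = {w'. homotopic G g E w w'}"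

section \<open>The fundamental group\<close>

definition closed_walks ::
  "('g, 'm) monoid_scheme \<Rightarrow> 'g \<Rightarrow> ('g, 'a) fbc_data \<Rightarrow> 'a \<Rightarrow> 'a walk set"
  where "closed_walks G g E e = {w. is_walk G g E w \<and> source w = e \<and> terminal w = e}"

text \<open>Operations on homotopy classes are unions over all representatives; since all
  representatives give the same class, this is the class of any one of them
  (see \<open>fundamental_group_mult\<close> and \<open>induced_map_class\<close>).\<close>

definition fundamental_group ::
  "('g, 'm) monoid_scheme \<Rightarrow> 'g \<Rightarrow> ('g, 'a) fbc_data \<Rightarrow> 'a \<Rightarrow> 'a walk set monoid"
  where "fundamental_group G g E e =
    \<lparr>carrier = homotopy_class G g E ` closed_walks G g E e,
     monoid.mult = (\<lambda>X Y. \<Union>u \<in> X. \<Union>v \<in> Y. homotopy_class G g E (u \<cdot> v)),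
     one = homotopy_class G g E (Trivial e)\<rparr>"

text \<open>The map on homotopy classes induced by \<open>f\<close>; the configuration argument is the target.
  The datatype map \<open>map_walk f\<close> applies \<open>f\<close> to all angles and keeps the steps.\<close>

definition induced_map ::
  "('g, 'm) monoid_scheme \<Rightarrow> 'g \<Rightarrow> ('g, 'b) fbc_data \<Rightarrow> ('a \<Rightarrow> 'b) \<Rightarrow> 'a walk set \<Rightarrow> 'b walk set"
  where "induced_map G g E' f X = (\<Union>w \<in> X. homotopy_class G g E' (map_walk f w))"

subsection \<open>Well-definedness\<close>

lemma terminal_comp [simp]: "terminal v = source u \<Longrightarrow> terminal (u \<cdot> v) = terminal u"
  by (cases u) auto

lemma source_comp [simp]: "source (u \<cdot> v) = source v"
  by (induction u) auto

lemma comp_assoc: "(u \<cdot> v) \<cdot> w = u \<cdot> (v \<cdot> w)"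
  by (induction u) auto

lemma comp_Trivial: "source u = e \<Longrightarrow> u \<cdot> Trivial e = u"
  by (induction u) auto

lemma is_walk_comp:
  "\<lbrakk>is_walk G g E u; is_walk G g E v; terminal v = source u\<rbrakk> \<Longrightarrow> is_walk G g E (u \<cdot> v)"
  by (induction u) auto

lemma source_map_walk [simp]: "source (map_walk f w) = f (source w)"
  by (induction w) auto

lemma terminal_map_walk [simp]: "terminal (map_walk f w) = f (terminal w)"
  by (cases w) auto

lemma map_walk_comp [simp]: "map_walk f (u \<cdot> v) = map_walk f u \<cdot> map_walk f v"
  by (induction u) auto

lemma is_walk_terminal: "is_walk G g E w \<Longrightarrow> terminal w \<in> angles E"
  by (cases w) auto

lemma is_walk_source: "is_walk G g E w \<Longrightarrow> source w \<in> angles E"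
  by (induction w) auto

context fractional_BC
begin

lemma act_closed: "\<lbrakk>x \<in> carrier G; e \<in> angles E\<rbrakk> \<Longrightarrow> act E x e \<in> angles E"
  using element_image by blast

lemma act_act:
  "\<lbrakk>x \<in> carrier G; y \<in> carrier G; e \<in> angles E\<rbrakk> \<Longrightarrow> act E x (act E y e) = act E (x \<otimes> y) e"
  using composition_rule by simp

lemma act_one: "e \<in> angles E \<Longrightarrow> act E \<one> e = e"
  using id_eq_one by (metis restrict_apply')

lemma act_inv: "e \<in> angles E \<Longrightarrow> act E (inv g) (act E g e) = e"
  and act_inv': "e \<in> angles E \<Longrightarrow> act E g (act E (inv g) e) = e"
  using gen_closed by (simp_all add: act_act act_one)

lemma source_pow_walk: "source (pow_walk G g E n e) = e"
  by (induction n) auto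

lemma terminal_pow_walk: "e \<in> angles E \<Longrightarrow> terminal (pow_walk G g E n e) = pow_act G g E n e"
  using gen_closed by (cases n) (auto simp: act_one)

lemma is_walk_pow_walk: "e \<in> angles E \<Longrightarrow> is_walk G g E (pow_walk G g E n e)"
proof (induction n)
  case (Suc n)
  then have "act E (g [^] Suc n) e = act E g (act E (g [^] n) e)"
    using gen_closed act_act nat_pow_Suc2 nat_pow_closed by metis
  with Suc show ?case
    using gen_closed by (auto simp: terminal_pow_walk act_closed simp del: nat_pow_Suc)
qed auto

lemma block_of_eq:
  assumes "partition_on A Q" "X \<in> Q" "e \<in> X"
  shows "block_of Q e = X"
  unfolding block_of_def using assms
  by (intro the_equality) (auto simp: partition_on_def pairwise_def disjnt_iff)

lemma block_of_self:
  assumes "partition_on A Q" "e \<in> A"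
  shows "block_of Q e \<in> Q \<and> e \<in> block_of Q e"
  using assms block_of_eq[OF assms(1)] by (metis UnionE partition_onD1)

lemma Lcl_imp_Pcl:
  assumes "e \<in> angles E" "h \<in> angles E" "Lcl E e = Lcl E h"
  shows "Pcl E e = Pcl E h"
  using assms f1 block_of_self[OF partition_lines] block_of_self[OF partition_polygons]
    block_of_eq[OF partition_polygons] by (metis subsetD)

lemma homotopic_walks:
  assumes "homotopic G g E w w'"
  shows "is_walk G g E w \<and> is_walk G g E w' \<and> source w = source w' \<and> terminal w = terminal w'"
  using assms
proof (induction rule: homotopic.induct)
  case (h3 e h)
  then have "Pcl E (pow_act G g E (deg E h) h) = Pcl E (pow_act G g E (deg E e) e)"
    using f4 by metis
  with h3 show ?case
    using gen_closed
    by (auto simp: is_walk_pow_walk terminal_pow_walk source_pow_walk act_closed intro!: is_walk_comp)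
next
  case (h4 e h)
  then have "Pcl E (act E g h) = Pcl E (act E g e)" "Pcl E h = Pcl E e"
    using f2 Lcl_imp_Pcl by metis+
  with h4 show ?case
    using gen_closed by (auto simp: act_closed)
qed (auto simp: act_closed gen_closed act_inv act_inv' is_walk_comp)

lemma homotopy_class_eq_iff:
  assumes "is_walk G g E u"
  shows "homotopy_class G g E u = homotopy_class G g E v \<longleftrightarrow> homotopic G g E u v"
  unfolding homotopy_class_def using assms by (blast intro: homotopic.intros)

lemma homotopic_comp:
  assumes "homotopic G g E u u'" "homotopic G g E v v'" "terminal v = source u"
  shows "homotopic G g E (u \<cdot> v) (u' \<cdot> v')"
proof -
  have "homotopic G g E (u \<cdot> v) (u' \<cdot> v)"
    using assms homotopic_walks by (intro homotopic.h5_right) metis+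
  moreover have "homotopic G g E (u' \<cdot> v) (u' \<cdot> v')"
    using assms homotopic_walks by (intro homotopic.h5_left) metis+
  ultimately show ?thesis
    by (rule homotopic.trans)
qed

lemma fundamental_group_mult:
  assumes "u \<in> closed_walks G g E e" "v \<in> closed_walks G g E e"
  shows "homotopy_class G g E u \<otimes>\<^bsub>fundamental_group G g E e\<^esub> homotopy_class G g E v
    = homotopy_class G g E (u \<cdot> v)"
proof -
  have "homotopy_class G g E (u' \<cdot> v') = homotopy_class G g E (u \<cdot> v)"
    if "homotopic G g E u u'" "homotopic G g E v v'" for u' v'
    using assms that
    by (metis (mono_tags, lifting) closed_walks_def homotopic_comp homotopic_walks
        homotopy_class_eq_iff mem_Collect_eq is_walk_comp)
  then have "(\<Union>u' \<in> homotopy_class G g E u. \<Union>v' \<in> homotopy_class G g E v.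
      homotopy_class G g E (u' \<cdot> v')) = (\<Union>u' \<in> homotopy_class G g E u.
      \<Union>v' \<in> homotopy_class G g E v. homotopy_class G g E (u \<cdot> v))"
    unfolding homotopy_class_def[of _ _ _ u] homotopy_class_def[of _ _ _ v]
    by (intro SUP_cong HOL.refl) blast
  moreover have "u \<in> homotopy_class G g E u" "v \<in> homotopy_class G g E v"
    using assms by (auto simp: closed_walks_def homotopy_class_def intro: homotopic.refl)
  ultimately show ?thesis
    by (auto simp only: fundamental_group_def monoid.simps)
qed

lemma homotopic_inverse_walk:
  assumes "is_walk G g E w"
  shows "\<exists>v. is_walk G g E v \<and> source v = terminal w \<and> terminal v = source w
    \<and> homotopic G g E (v \<cdot> w) (Trivial (source w))"
  using assms
proof (induction w)
  case (Trivial e)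
  then show ?case
    by (intro exI[of _ "Trivial e"]) (auto intro: homotopic.refl)
next
  case (Step e \<delta> w)
  then obtain v where v: "is_walk G g E v" "source v = terminal w" "terminal v = source w"
      "homotopic G g E (v \<cdot> w) (Trivial (source w))"
    by auto
  have w: "is_walk G g E w" "terminal w \<in> angles E" "e \<in> angles E"
    using Step is_walk_terminal by auto
  obtain \<epsilon> where \<epsilon>: "is_walk G g E (Step (terminal w) \<epsilon> (Trivial e))"
    "homotopic G g E (Step (terminal w) \<epsilon> (Step e \<delta> (Trivial (terminal w)))) (Trivial (terminal w))"
  proof (cases \<delta>)
    case Fwd
    then have "e = act E g (terminal w)"
      using Step.prems by simp
    then show ?thesis
      using w homotopic.h1_Bwd_Fwd[OF w(2), of G g] Fwd
      by (intro that[of Bwd]) (simp_all add: act_inv)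
  next
    case Bwd
    then have "e = act E (inv g) (terminal w)"
      using Step.prems by simp
    then show ?thesis
      using w homotopic.h1_Fwd_Bwd[OF w(2), of G g] Bwd
      by (intro that[of Fwd]) (simp_all add: act_inv')
  next
    case Tau
    then have P: "Pcl E e = Pcl E (terminal w)"
      using Step.prems by simp
    have "homotopic G g E (Step (terminal w) Tau (Step e Tau (Trivial (terminal w))))
        (Trivial (terminal w))"
      by (rule homotopic.trans[OF homotopic.h2 homotopic.h1_Tau]) (simp_all add: w P)
    then show ?thesis
      using w P Tau by (intro that[of Tau]) simp_all
  qed
  let ?s = "Step (terminal w) \<epsilon> (Trivial e)"
  have "homotopic G g E (Step (terminal w) \<epsilon> (Step e \<delta> (Trivial (terminal w))) \<cdot> w)
      (Trivial (terminal w) \<cdot> w)"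
    using \<epsilon> w by (intro homotopic.h5_right) auto
  then have "homotopic G g E (v \<cdot> (Step (terminal w) \<epsilon> (Step e \<delta> w))) (v \<cdot> w)"
    using v by (intro homotopic.h5_left) auto
  then have "homotopic G g E ((v \<cdot> ?s) \<cdot> Step e \<delta> w) (Trivial (source w))"
    using homotopic.trans[OF _ v(4)] by (simp add: comp_assoc)
  then have "homotopic G g E ((v \<cdot> ?s) \<cdot> Step e \<delta> w) (Trivial (source (Step e \<delta> w)))"
    by simp
  moreover have "is_walk G g E (v \<cdot> ?s)"
    using v \<epsilon>(1) by (intro is_walk_comp) simp_all
  moreover have "source (v \<cdot> ?s) = terminal (Step e \<delta> w)" "terminal (v \<cdot> ?s) = source (Step e \<delta> w)"
    using v by simp_all
  ultimately show ?case
    by blast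
qed

lemma group_fundamental_group:
  assumes "e \<in> angles E"
  shows "group (fundamental_group G g E e)"
proof -
  have carrier: "carrier (fundamental_group G g E e) = homotopy_class G g E ` closed_walks G g E e"
    and one: "\<one>\<^bsub>fundamental_group G g E e\<^esub> = homotopy_class G g E (Trivial e)"
    by (simp_all add: fundamental_group_def)
  have comp: "u \<cdot> v \<in> closed_walks G g E e"
    if "u \<in> closed_walks G g E e" "v \<in> closed_walks G g E e" for u v
    using that by (auto simp: closed_walks_def is_walk_comp)
  have triv: "Trivial e \<in> closed_walks G g E e"
    using assms by (simp add: closed_walks_def)
  have inv: "\<exists>v \<in> closed_walks G g E e.
      homotopy_class G g E (v \<cdot> w) = homotopy_class G g E (Trivial e)"
    if w: "w \<in> closed_walks G g E e" for w
  proof -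
    obtain v where "v \<in> closed_walks G g E e" "homotopic G g E (v \<cdot> w) (Trivial e)"
      using homotopic_inverse_walk[of w] w by (auto simp: closed_walks_def)
    then show ?thesis
      using homotopy_class_eq_iff homotopic_walks by blast
  qed
  show ?thesis
  proof (rule groupI)
    fix X assume "X \<in> carrier (fundamental_group G g E e)"
    then obtain w where w: "w \<in> closed_walks G g E e" "X = homotopy_class G g E w"
      by (auto simp: carrier)
    then show "\<one>\<^bsub>fundamental_group G g E e\<^esub> \<otimes>\<^bsub>fundamental_group G g E e\<^esub> X = X"
      by (simp add: one triv fundamental_group_mult)
    obtain v where "v \<in> closed_walks G g E e"
        "homotopy_class G g E (v \<cdot> w) = homotopy_class G g E (Trivial e)"
      using inv w by blast
    then show "\<exists>Y \<in> carrier (fundamental_group G g E e).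
        Y \<otimes>\<^bsub>fundamental_group G g E e\<^esub> X = \<one>\<^bsub>fundamental_group G g E e\<^esub>"
      using w by (intro bexI[of _ "homotopy_class G g E v"])
        (simp_all add: one carrier fundamental_group_mult)
  next
    fix X Y assume "X \<in> carrier (fundamental_group G g E e)" "Y \<in> carrier (fundamental_group G g E e)"
    then obtain u v where "u \<in> closed_walks G g E e" "X = homotopy_class G g E u"
      "v \<in> closed_walks G g E e" "Y = homotopy_class G g E v"
      by (auto simp: carrier)
    then show "X \<otimes>\<^bsub>fundamental_group G g E e\<^esub> Y \<in> carrier (fundamental_group G g E e)"
      by (simp add: carrier comp fundamental_group_mult)
  next
    show "\<one>\<^bsub>fundamental_group G g E e\<^esub> \<in> carrier (fundamental_group G g E e)"
      by (simp add: carrier one triv)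
  next
    fix X Y Z
    assume "X \<in> carrier (fundamental_group G g E e)" "Y \<in> carrier (fundamental_group G g E e)"
      "Z \<in> carrier (fundamental_group G g E e)"
    then obtain u v w where "u \<in> closed_walks G g E e" "X = homotopy_class G g E u"
      "v \<in> closed_walks G g E e" "Y = homotopy_class G g E v"
      "w \<in> closed_walks G g E e" "Z = homotopy_class G g E w"
      by (auto simp: carrier)
    then show "X \<otimes>\<^bsub>fundamental_group G g E e\<^esub> Y \<otimes>\<^bsub>fundamental_group G g E e\<^esub> Z
      = X \<otimes>\<^bsub>fundamental_group G g E e\<^esub> (Y \<otimes>\<^bsub>fundamental_group G g E e\<^esub> Z)"
      by (simp add: comp comp_assoc fundamental_group_mult)
  qed
qed

end

lemma map_pow_walk:
  assumes "fractional_BC G g E" "fbc_morphism G E E' f" "e \<in> angles E"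
  shows "map_walk f (pow_walk G g E n e) = pow_walk G g E' n (f e)"
proof -
  interpret fractional_BC G g E by fact
  show ?thesis
    using assms gen_closed by (induction n) (auto simp: fbc_morphism_def simp del: nat_pow_Suc)
qed

lemma morphism_Pcl:
  assumes "fractional_BC G g E" "fractional_BC G g E'" "fbc_morphism G E E' f"
    and "e \<in> angles E" "h \<in> angles E"
  shows "Pcl E e = Pcl E h \<Longrightarrow> Pcl E' (f e) = Pcl E' (f h)"
    and "Lcl E e = Lcl E h \<Longrightarrow> Lcl E' (f e) = Lcl E' (f h)"
proof -
  interpret E: fractional_BC G g E by fact
  interpret E': fractional_BC G g E' by fact
  have h: "f h \<in> angles E'" "f e \<in> angles E'"
    using assms by (auto simp: fbc_morphism_def)
  show "Pcl E' (f e) = Pcl E' (f h)" if "Pcl E e = Pcl E h"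
  proof -
    have "f h \<in> Pcl E' (f e)"
      using that assms E.block_of_self[OF E.partition_polygons, of h]
      unfolding fbc_morphism_def by (metis image_subset_iff)
    then show ?thesis
      using E'.block_of_self[OF E'.partition_polygons h(2)]
        E'.block_of_eq[OF E'.partition_polygons] by blast
  qed
  show "Lcl E' (f e) = Lcl E' (f h)" if "Lcl E e = Lcl E h"
  proof -
    have "f h \<in> Lcl E' (f e)"
      using that assms E.block_of_self[OF E.partition_lines, of h]
      unfolding fbc_morphism_def by (metis image_subset_iff)
    then show ?thesis
      using E'.block_of_self[OF E'.partition_lines h(2)]
        E'.block_of_eq[OF E'.partition_lines] by blast
  qed
qed

lemma is_walk_map:
  assumes "fractional_BC G g E" "fractional_BC G g E'" "fbc_morphism G E E' f"
    and "is_walk G g E w"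
  shows "is_walk G g E' (map_walk f w)"
proof -
  interpret E: fractional_BC G g E by fact
  show ?thesis
    using assms(4)
  proof (induction w)
    case (Trivial e)
    then show ?case using assms(3) by (auto simp: fbc_morphism_def)
  next
    case (Step e \<delta> w)
    then have w: "terminal w \<in> angles E" "e \<in> angles E" "valid_step G g E e \<delta> (terminal w)"
      using is_walk_terminal by auto
    then have "valid_step G g E' (f e) \<delta> (f (terminal w))"
      using morphism_Pcl(1)[OF assms(1-3) w(2,1)] assms(3) E.gen_closed
      by (cases \<delta>) (simp_all add: fbc_morphism_def)
    with Step w assms(3) show ?case
      by (auto simp: fbc_morphism_def)
  qed
qed

lemma homotopic_map:
  assumes "fractional_BC G g E" "fractional_BC G g E'" "fbc_morphism G E E' f"
    and "homotopic G g E w w'"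
  shows "homotopic G g E' (map_walk f w) (map_walk f w')"
proof -
  interpret E: fractional_BC G g E by fact
  have f: "\<And>e. e \<in> angles E \<Longrightarrow> f e \<in> angles E'"
    "\<And>x e. x \<in> carrier G \<Longrightarrow> e \<in> angles E \<Longrightarrow> f (act E x e) = act E' x (f e)"
    "\<And>e. e \<in> angles E \<Longrightarrow> deg E' (f e) = deg E e"
    using assms(3) by (auto simp: fbc_morphism_def)
  note P = morphism_Pcl[OF assms(1-3)]
  note W = is_walk_map[OF assms(1-3)]
  show ?thesis
    using assms(4)
  proof (induction rule: homotopic.induct)
    case (trans w1 w2 w3)
    show ?case by (rule homotopic.trans[OF trans.IH])
  next
    case (h2 e0 e1 e2)
    then show ?case using homotopic.h2[of "f e0" E' "f e1" "f e2" G g] P(1)[of e1 e0] P(1)[of e2 e1] f(1) by simp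
  next
    case (h3 e h)
    then show ?case
      using homotopic.h3[of "f e" E' "f h" G g] P(1)[of e h] f E.gen_closed map_pow_walk[OF assms(1,3)] by simp
  next
    case (h4 e h)
    then show ?case using homotopic.h4[of "f e" E' "f h" G g] P(2)[of e h] f E.gen_closed by simp
  qed (auto simp: f E.gen_closed W intro: homotopic.intros)
qed

lemma induced_map_class:
  assumes "fractional_BC G g E" "fractional_BC G g E'" "fbc_morphism G E E' f"
    and "is_walk G g E w"
  shows "induced_map G g E' f (homotopy_class G g E w) = homotopy_class G g E' (map_walk f w)"
proof -
  interpret E: fractional_BC G g E by fact
  interpret E': fractional_BC G g E' by fact
  have "homotopy_class G g E' (map_walk f v) = homotopy_class G g E' (map_walk f w)"
    if "homotopic G g E w v" for v
    using homotopic_map[OF assms(1-3) that] E'.homotopy_class_eq_iff is_walk_map assms by metis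
  then have "induced_map G g E' f (homotopy_class G g E w)
      = (\<Union>v \<in> homotopy_class G g E w. homotopy_class G g E' (map_walk f w))"
    unfolding induced_map_def homotopy_class_def[of _ _ _ w]
    by (intro SUP_cong HOL.refl) blast
  moreover have "w \<in> homotopy_class G g E w"
    using assms(4) by (simp add: homotopy_class_def homotopic.refl)
  ultimately show ?thesis
    by auto
qed

lemma induced_map_hom:
  assumes "fractional_BC G g E" "fractional_BC G g E'" "fbc_morphism G E E' f"
  shows "induced_map G g E' f \<in> hom (fundamental_group G g E e) (fundamental_group G g E' (f e))"
proof -
  interpret E: fractional_BC G g E by fact
  interpret E': fractional_BC G g E' by fact
  have map: "map_walk f u \<in> closed_walks G g E' (f e)" if "u \<in> closed_walks G g E e" for u
    using that is_walk_map[OF assms] by (auto simp: closed_walks_def)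
  have ind: "induced_map G g E' f (homotopy_class G g E u) = homotopy_class G g E' (map_walk f u)"
    if "u \<in> closed_walks G g E e" for u
    using that induced_map_class[OF assms] by (auto simp: closed_walks_def)
  have comp: "u \<cdot> v \<in> closed_walks G g E e"
    if "u \<in> closed_walks G g E e" "v \<in> closed_walks G g E e" for u v
    using that by (auto simp: closed_walks_def is_walk_comp)
  have carrier: "\<And>e. carrier (fundamental_group G g E e) = homotopy_class G g E ` closed_walks G g E e"
    "\<And>e. carrier (fundamental_group G g E' e) = homotopy_class G g E' ` closed_walks G g E' e"
    by (simp_all add: fundamental_group_def)
  show ?thesis
    by (rule homI)
      (auto simp: carrier ind map comp E.fundamental_group_mult E'.fundamental_group_mult)
qed

end

theory Submission
  imports Defs
begin

text \<open>
  As for covering spaces, a walk in the base lifts uniquely once its source (or its terminal) is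
  lifted, and homotopies lift because each elementary homotopy does: a covering is bijective on
  polygons, which lifts \<open>\<tau>\<close>-steps, and on the classes of \<open>L\<close>, which lifts (h4).
  The map \<open>\<phi>\<close> sends the terminal of a walk from \<open>e1\<close> to the terminal of the lift at
  \<open>e2\<close> of its image in \<open>E\<close>; the condition on fundamental groups says that this
  does not depend on the walk.
\<close>

section \<open>Images of walks under maps of angles\<close>

lemma set_walk_subset: "is_walk G g E w \<Longrightarrow> set_walk w \<subseteq> angles E"
  by (induction w) auto

text \<open>The maps \<open>f\<close> and \<open>p \<circ> \<phi>\<close> agree only on angles,
  which suffices because a walk visits nothing else.\<close>

lemma map_walk_factor:
  assumes "is_walk G g E w" "\<forall>e \<in> angles E. f e = p (\<phi> e)"
  shows "map_walk f w = map_walk p (map_walk \<phi> w)"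
  using set_walk_subset[OF assms(1)] assms(2)
  by (auto simp: walk.map_comp intro!: walk.map_cong)

text \<open>Needed for (h5): a lift of a composite must be cut over the point where the two factors
  meet.\<close>

lemma map_walk_eq_comp:
  assumes "map_walk f w = u \<cdot> v" "terminal v = source u" "is_walk G g E w"
  shows "\<exists>a b. w = a \<cdot> b \<and> map_walk f a = u \<and> map_walk f b = v \<and> terminal b = source a
    \<and> is_walk G g E a \<and> is_walk G g E b"
  using assms
proof (induction u arbitrary: w)
  case (Trivial e)
  then show ?case
    by (intro exI[of _ "Trivial (terminal w)"] exI[of _ w]) (auto simp: is_walk_terminal)
next
  case (Step e \<delta> u)
  obtain e' w' where w: "w = Step e' \<delta> w'" "f e' = e" "map_walk f w' = u \<cdot> v"
    using Step.prems(1) by (cases w) auto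
  obtain a b where ab: "w' = a \<cdot> b" "map_walk f a = u" "map_walk f b = v" "terminal b = source a"
    "is_walk G g E a" "is_walk G g E b"
    using Step.IH[OF w(3)] Step.prems w by auto
  then show ?case
    using w Step.prems by (intro exI[of _ "Step e' \<delta> a"] exI[of _ b]) auto
qed

section \<open>Blocks and equivariance\<close>

context fractional_BC
begin

lemma mem_Pcl_iff:
  assumes "e \<in> angles E"
  shows "h \<in> Pcl E e \<longleftrightarrow> h \<in> angles E \<and> Pcl E h = Pcl E e"
  using assms block_of_self[OF partition_polygons] block_of_eq[OF partition_polygons]
    partition_onD1[OF partition_polygons] by (metis UnionI)

lemma mem_Lcl_iff:
  assumes "e \<in> angles E"
  shows "h \<in> Lcl E e \<longleftrightarrow> h \<in> angles E \<and> Lcl E h = Lcl E e"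
  using assms block_of_self[OF partition_lines] block_of_eq[OF partition_lines]
    partition_onD1[OF partition_lines] by (metis UnionI)

text \<open>Walks only see \<open>g\<close> and its inverse, whereas a morphism must commute with
  all of \<open>G\<close>. Induction on \<open>generate G {g}\<close> closes this gap.\<close>

lemma equivariant_if_generator:
  assumes "fractional_BC G g E'" "f \<in> angles E \<rightarrow> angles E'"
    and fwd: "\<And>e. e \<in> angles E \<Longrightarrow> f (act E g e) = act E' g (f e)"
    and "x \<in> carrier G" "e \<in> angles E"
  shows "f (act E x e) = act E' x (f e)"
proof -
  interpret E': fractional_BC G g E' by fact
  \<comment> \<open>Apply \<open>fwd\<close> at \<open>act E (inv g) e\<close> and cancel
    \<open>g\<close> in the target.\<close>
  have bwd: "f (act E (inv g) e) = act E' (inv g) (f e)" if "e \<in> angles E" for e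
  proof -
    have h: "act E (inv g) e \<in> angles E"
      using that gen_closed by (simp add: act_closed)
    then have "act E' (inv g) (f e) = act E' (inv g) (act E' g (f (act E (inv g) e)))"
      using fwd[OF h] that by (simp add: act_inv')
    then show ?thesis
      using h assms(2) by (simp add: E'.act_inv Pi_iff)
  qed
  have "x \<in> generate G {g}"
    using assms(4) generates by simp
  then have "\<forall>e \<in> angles E. f (act E x e) = act E' x (f e)"
  proof (induction x rule: generate.induct)
    case one
    then show ?case using assms(2) by (simp add: act_one E'.act_one Pi_iff)
  next
    case (eng x y)
    then have xy: "x \<in> carrier G" "y \<in> carrier G"
      using generates by auto
    show ?case
    proof
      fix e assume e: "e \<in> angles E"
      have "f (act E (x \<otimes> y) e) = f (act E x (act E y e))"
        using e xy by (simp add: act_act)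
      also have "\<dots> = act E' x (act E' y (f e))"
        using e xy eng.IH by (simp add: act_closed)
      also have "\<dots> = act E' (x \<otimes> y) (f e)"
        using e xy assms(2) by (simp add: E'.act_act Pi_iff)
      finally show "f (act E (x \<otimes> y) e) = act E' (x \<otimes> y) (f e)" .
    qed
  qed (auto simp: fwd bwd)
  then show ?thesis
    using assms(5) by blast
qed

end

section \<open>Lifting along coverings\<close>

locale fbc_cover = cov: fractional_BC G g C + base: fractional_BC G g E
  for G (structure) and g and C :: "('g, 'c) fbc_data" and E :: "('g, 'a) fbc_data" +
  fixes p :: "'c \<Rightarrow> 'a"
  assumes covering: "fbc_covering G C E p"
begin

section \<open>Local bijectivity of the projection\<close>

lemma morphism: "fbc_morphism G C E p"
  using covering by (simp add: fbc_covering_def)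

lemma proj_closed: "x \<in> angles C \<Longrightarrow> p x \<in> angles E"
  and proj_act: "\<lbrakk>z \<in> carrier G; x \<in> angles C\<rbrakk> \<Longrightarrow> p (act C z x) = act E z (p x)"
  and proj_deg: "x \<in> angles C \<Longrightarrow> deg E (p x) = deg C x"
  using morphism by (auto simp: fbc_morphism_def)

lemma proj_inj:
  assumes "x \<in> angles C" "y \<in> angles C" "Pcl C x = Pcl C y" "p x = p y"
  shows "x = y"
proof -
  have "inj_on p (Pcl C x)"
    using covering assms by (auto simp: fbc_covering_def bij_betw_def)
  moreover have "x \<in> Pcl C x" "y \<in> Pcl C x"
    using assms by (auto simp: cov.mem_Pcl_iff)
  ultimately show ?thesis
    using assms(4) by (auto dest: inj_onD)
qed

lemma lift_Pcl:
  assumes "x \<in> angles C" "h \<in> angles E" "Pcl E h = Pcl E (p x)"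
  obtains y where "y \<in> angles C" "Pcl C y = Pcl C x" "p y = h"
proof -
  have "p ` Pcl C x = Pcl E (p x)"
    using covering assms by (auto simp: fbc_covering_def bij_betw_def)
  moreover have "h \<in> Pcl E (p x)"
    using assms by (simp add: base.mem_Pcl_iff proj_closed)
  ultimately obtain y where "y \<in> Pcl C x" "h = p y"
    by blast
  then show ?thesis
    using assms(1) by (intro that[of y]) (auto simp: cov.mem_Pcl_iff)
qed

text \<open>Lifting inside the polygon alone would not do for (h4), nor for showing that
  \<open>\<phi>\<close> respects lines.\<close>

lemma lift_Lcl:
  assumes "x \<in> angles C" "h \<in> angles E" "Lcl E h = Lcl E (p x)"
  obtains y where "y \<in> angles C" "Lcl C y = Lcl C x" "p y = h"
proof -
  have "p ` Lcl C x = Lcl E (p x)"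
    using covering assms by (auto simp: fbc_covering_def bij_betw_def)
  moreover have "h \<in> Lcl E (p x)"
    using assms by (simp add: base.mem_Lcl_iff proj_closed)
  ultimately obtain y where "y \<in> Lcl C x" "h = p y"
    by blast
  then show ?thesis
    using assms(1) by (intro that[of y]) (auto simp: cov.mem_Lcl_iff)
qed

section \<open>Lifting of walks and homotopies\<close>

lemma lift_step:
  assumes "x \<in> angles C" "e \<in> angles E" "valid_step G g E e \<delta> (p x)"
  obtains y where "y \<in> angles C" "valid_step G g C y \<delta> x" "p y = e"
proof (cases \<delta>)
  case Tau
  then show ?thesis
    using lift_Pcl[of x e] assms that by auto
qed (use assms that cov.gen_closed in \<open>auto simp: proj_act cov.act_closed\<close>)

lemma lift_walk_exists:
  assumes "is_walk G g E v" "x \<in> angles C" "source v = p x"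
  obtains u where "is_walk G g C u" "source u = x" "map_walk p u = v"
proof -
  have "\<exists>u. is_walk G g C u \<and> source u = x \<and> map_walk p u = v"
    using assms
  proof (induction v)
    case (Trivial e)
    then show ?case
      by (intro exI[of _ "Trivial x"]) auto
  next
    case (Step e \<delta> v)
    then obtain u where u: "is_walk G g C u" "source u = x" "map_walk p u = v"
      by auto
    then obtain y where "y \<in> angles C" "valid_step G g C y \<delta> (terminal u)" "p y = e"
      using lift_step[of "terminal u" e \<delta>] Step.prems
      by (auto simp: is_walk_terminal simp flip: u(3))
    with u show ?case
      by (intro exI[of _ "Step y \<delta> u"]) auto
  qed
  then show ?thesis
    using that by blast
qed

text \<open>A \<open>Fwd\<close> or \<open>Bwd\<close> step determines its new angle. After a
  \<open>Tau\<close> step the two candidates share a polygon and an image, so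
  \<open>proj_inj\<close> applies.\<close>

lemma lift_walk_unique:
  assumes "is_walk G g C u" "is_walk G g C u'" "source u = source u'" "map_walk p u = map_walk p u'"
  shows "u = u'"
  using assms
proof (induction u arbitrary: u')
  case (Trivial x)
  then show ?case
    by (cases u') auto
next
  case (Step x \<delta> u)
  then obtain x' v where u': "u' = Step x' \<delta> v" "p x = p x'" "map_walk p u = map_walk p v"
    by (cases u') auto
  then have "u = v"
    using Step by auto
  moreover have "x = x'"
    using Step.prems u' proj_inj[of x x'] \<open>u = v\<close> by (cases \<delta>) auto
  ultimately show ?case
    using u' by simp
qed

text \<open>Used when lifts are known to end together but not to start together. Each step is undone
  from its end: by the inverse group element, or by \<open>proj_inj\<close> for
  \<open>Tau\<close>.\<close>

lemma lift_walk_unique_terminal: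
  assumes "is_walk G g C u" "is_walk G g C u'" "terminal u = terminal u'"
    and "map_walk p u = map_walk p u'"
  shows "u = u'"
  using assms
proof (induction u arbitrary: u')
  case (Trivial x)
  then show ?case
    by (cases u') auto
next
  case (Step x \<delta> u)
  then obtain v where u': "u' = Step x \<delta> v" "map_walk p u = map_walk p v"
    by (cases u') auto
  have "p (terminal u) = p (terminal v)"
    using u'(2) by (metis terminal_map_walk)
  then have "terminal u = terminal v"
    using Step.prems u' proj_inj[of "terminal u" "terminal v"]
    by (cases \<delta>) (auto dest!: is_walk_terminal, (metis cov.act_inv cov.act_inv')+)
  then show ?case
    using Step u' by auto
qed

text \<open>Induction on the homotopy below: each elementary homotopy has a lift at the given
  source, and unique lifting identifies its two sides with \<open>u\<close> and \<open>u'\<close>.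
  Only the sources are assumed equal; the gain is that the terminals then agree as well.\<close>

lemma lift_homotopic:
  assumes "homotopic G g E v v'"
    and "is_walk G g C u" "is_walk G g C u'" "source u = source u'"
    and "map_walk p u = v" "map_walk p u' = v'"
  shows "homotopic G g C u u'"
proof -
  \<comment> \<open>Reduces each elementary case to naming one instance of the same relation in
    \<open>C\<close> with the right source and projections.\<close>
  have by_witness: "homotopic G g C u u'"
    if "homotopic G g C a a'" "is_walk G g C u" "is_walk G g C u'" "source a = source u"
      "source u = source u'" "map_walk p u = map_walk p a" "map_walk p u' = map_walk p a'"
    for a a' u u'
    using that cov.homotopic_walks[OF that(1)] lift_walk_unique[of u a] lift_walk_unique[of u' a']
    by simp
  have src: "source u \<in> angles C \<and> p (source u) = source (map_walk p u)"
    if "is_walk G g C u" for u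
    using that by (simp add: is_walk_source)
  show ?thesis
    using assms
  proof (induction arbitrary: u u' rule: homotopic.induct)
    case (refl w)
    then show ?case
      using lift_walk_unique[of u u'] by (auto intro: homotopic.refl)
  next
    case (sym w1 w2)
    have "homotopic G g C u' u"
      using sym.prems by (intro sym.IH) auto
    then show ?case
      by (rule homotopic.sym)
  next
    case (trans w1 w2 w3)
    \<comment> \<open>The intermediate walk comes without a lift. It has the same source as
      \<open>w1\<close>, so it can be lifted at \<open>source u\<close>.\<close>
    have "is_walk G g E w2" "source w2 = p (source u)"
      using base.homotopic_walks[OF trans.hyps(1)] trans.prems by auto
    then obtain b where b: "is_walk G g C b" "source b = source u" "map_walk p b = w2"
      using lift_walk_exists[of w2 "source u"] trans.prems is_walk_source by metis
    have "homotopic G g C u b" "homotopic G g C b u'"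
      using trans.IH trans.prems b by simp_all
    then show ?case
      by (rule homotopic.trans)
  next
    case (h1_Bwd_Fwd e)
    then show ?case
      using src[of u] cov.gen_closed
      by (intro by_witness[OF homotopic.h1_Bwd_Fwd[of "source u"]]) (auto simp: proj_act)
  next
    case (h1_Fwd_Bwd e)
    then show ?case
      using src[of u] cov.gen_closed
      by (intro by_witness[OF homotopic.h1_Fwd_Bwd[of "source u"]]) (auto simp: proj_act)
  next
    case (h1_Tau e)
    then show ?case
      using src[of u] by (intro by_witness[OF homotopic.h1_Tau[of "source u"]]) auto
  next
    case (h2 e0 e1 e2)
    have x0: "source u \<in> angles C" "p (source u) = e0"
      using src[of u] h2 by auto
    obtain x1 where x1: "x1 \<in> angles C" "Pcl C x1 = Pcl C (source u)" "p x1 = e1"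
      using lift_Pcl[of "source u" e1] h2 x0 by metis
    obtain x2 where x2: "x2 \<in> angles C" "Pcl C x2 = Pcl C x1" "p x2 = e2"
      using lift_Pcl[of x1 e2] h2 x1 by metis
    show ?case
      using x0 x1 x2 h2 by (intro by_witness[OF homotopic.h2[of "source u" C x1 x2]]) auto
  next
    case (h3 e h)
    have x: "source u \<in> angles C" "p (source u) = e"
      using src[of u] h3.prems by (auto simp: base.source_pow_walk)
    obtain y where y: "y \<in> angles C" "Pcl C y = Pcl C (source u)" "p y = h"
      using lift_Pcl[of "source u" h] h3 x by metis
    \<comment> \<open>The exponents in (h3) are degrees, and \<open>proj_deg\<close> makes them the
      same above and below.\<close>
    show ?case
      using x y h3 proj_deg[OF x(1)] proj_deg[OF y(1)] cov.gen_closed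
        map_pow_walk[OF cov.fractional_BC_axioms morphism]
      by (intro by_witness[OF homotopic.h3[of "source u" C y]])
        (auto simp: cov.source_pow_walk proj_act)
  next
    case (h4 e h)
    have x: "source u \<in> angles C" "p (source u) = e"
      using src[of u] h4.prems by auto
    \<comment> \<open>To be an instance of (h4) in \<open>C\<close>, the lift of \<open>h\<close>
      must lie in the line of \<open>source u\<close>.\<close>
    obtain y where y: "y \<in> angles C" "Lcl C y = Lcl C (source u)" "p y = h"
      using lift_Lcl[of "source u" h] h4 x by metis
    show ?case
      using x y h4 cov.gen_closed
      by (intro by_witness[OF homotopic.h4[of "source u" C y]]) (auto simp: proj_act)
  next
    case (h5_left w1 w2 v)
    obtain a b where ab: "u = a \<cdot> b" "map_walk p a = v" "map_walk p b = w1" "terminal b = source a"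
      "is_walk G g C a" "is_walk G g C b"
      using map_walk_eq_comp h5_left by metis
    obtain a' b' where ab': "u' = a' \<cdot> b'" "map_walk p a' = v" "map_walk p b' = w2"
      "terminal b' = source a'" "is_walk G g C a'" "is_walk G g C b'"
      using map_walk_eq_comp h5_left by metis
    \<comment> \<open>The varying factor is run first. Its lifts are homotopic by induction, hence
      end at one angle, where the lifts of the fixed factor then both start.\<close>
    have b: "homotopic G g C b b'"
      using h5_left.IH[of b b'] h5_left.prems ab ab' by simp
    then have "a = a'"
      using cov.homotopic_walks[OF b] ab ab' by (intro lift_walk_unique) auto
    then show ?case
      using b ab ab' by (auto intro: homotopic.h5_left)
  next
    case (h5_right w1 w2 v)
    obtain a b where ab: "u = a \<cdot> b" "map_walk p a = w1" "map_walk p b = v" "terminal b = source a"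
      "is_walk G g C a" "is_walk G g C b"
      using map_walk_eq_comp h5_right by metis
    obtain a' b' where ab': "u' = a' \<cdot> b'" "map_walk p a' = w2" "map_walk p b' = v"
      "terminal b' = source a'" "is_walk G g C a'" "is_walk G g C b'"
      using map_walk_eq_comp h5_right by metis
    \<comment> \<open>Now the fixed factor is run first, so its lifts coincide at once and give
      \<open>a\<close> and \<open>a'\<close> a common source.\<close>
    have "b = b'"
      using h5_right.prems ab ab' by (intro lift_walk_unique) auto
    then have "homotopic G g C a a'"
      using h5_right.IH[of a a'] ab ab' by simp
    then show ?case
      using ab ab' \<open>b = b'\<close> by (auto intro: homotopic.h5_right)
  qed
qed

end

section \<open>The lifting criterion\<close>

locale fbc_lifting = fbc_cover G g C E p + dom: fractional_BC G g D
  for G (structure) and g and C :: "('g, 'c) fbc_data" and E :: "('g, 'a) fbc_data" and p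
    and D :: "('g, 'b) fbc_data" +
  fixes f :: "'b \<Rightarrow> 'a" and d :: 'b and c :: 'c
  assumes f_morphism: "fbc_morphism G D E f"
    and dom_connected: "fbc_connected G g D"
    and d_angle: "d \<in> angles D" and c_angle: "c \<in> angles C" and base_points: "f d = p c"
begin

section \<open>Uniqueness of the lift and necessity of the condition\<close>

definition is_lift :: "('b \<Rightarrow> 'c) \<Rightarrow> bool"
  where "is_lift \<phi> \<longleftrightarrow> fbc_morphism G D C \<phi> \<and> (\<forall>e \<in> angles D. f e = p (\<phi> e)) \<and> \<phi> d = c"

lemma f_closed: "e \<in> angles D \<Longrightarrow> f e \<in> angles E"
  and f_act: "\<lbrakk>z \<in> carrier G; e \<in> angles D\<rbrakk> \<Longrightarrow> f (act D z e) = act E z (f e)"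
  and f_deg: "e \<in> angles D \<Longrightarrow> deg E (f e) = deg D e"
  using f_morphism by (auto simp: fbc_morphism_def)

lemma f_walk: "is_walk G g D w \<Longrightarrow> is_walk G g E (map_walk f w)"
  using is_walk_map f_morphism dom.fractional_BC_axioms base.fractional_BC_axioms by metis

text \<open>Join \<open>d\<close> to \<open>e\<close> by a walk. Its images under
  \<open>\<phi>\<close> and \<open>\<psi>\<close> start at \<open>c\<close> and have the same
  projection, so they coincide, and so do their terminals.\<close>

lemma lift_unique:
  assumes "is_lift \<phi>" "is_lift \<psi>" "e \<in> angles D"
  shows "\<phi> e = \<psi> e"
proof -
  obtain w where w: "is_walk G g D w" "source w = d" "terminal w = e"
    using dom_connected d_angle assms(3) by (auto simp: fbc_connected_def)
  have "is_walk G g C (map_walk \<phi> w)" "is_walk G g C (map_walk \<psi> w)"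
    using assms w is_walk_map dom.fractional_BC_axioms cov.fractional_BC_axioms
    by (metis is_lift_def)+
  moreover have "map_walk p (map_walk \<phi> w) = map_walk p (map_walk \<psi> w)"
    using map_walk_factor[OF w(1), of f p \<phi>] map_walk_factor[OF w(1), of f p \<psi>] assms
    by (simp add: is_lift_def)
  ultimately have "map_walk \<phi> w = map_walk \<psi> w"
    using assms w by (intro lift_walk_unique) (auto simp: is_lift_def)
  then show ?thesis
    using w by (metis terminal_map_walk)
qed

text \<open>Replaces homotopy classes by representatives; the rest of the argument works with walks
  only.\<close>

lemma fundamental_group_subset_iff:
  "induced_map G g E f ` carrier (fundamental_group G g D d)
      \<subseteq> induced_map G g E p ` carrier (fundamental_group G g C c) \<longleftrightarrow>
    (\<forall>w \<in> closed_walks G g D d. \<exists>u \<in> closed_walks G g C c.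
      homotopic G g E (map_walk f w) (map_walk p u))"
proof -
  have fw: "induced_map G g E f (homotopy_class G g D w) = homotopy_class G g E (map_walk f w)"
    "is_walk G g E (map_walk f w)"
    if "w \<in> closed_walks G g D d" for w
    using that f_walk induced_map_class[OF dom.fractional_BC_axioms base.fractional_BC_axioms f_morphism]
    by (auto simp: closed_walks_def)
  have pu: "induced_map G g E p (homotopy_class G g C u) = homotopy_class G g E (map_walk p u)"
    if "u \<in> closed_walks G g C c" for u
    using that induced_map_class[OF cov.fractional_BC_axioms base.fractional_BC_axioms morphism]
    by (auto simp: closed_walks_def)
  show ?thesis
    by (simp add: fundamental_group_def image_subset_iff image_iff fw pu
        base.homotopy_class_eq_iff cong: ball_cong_simp bex_cong_simp)
qed

text \<open>The image of \<open>w\<close> under \<open>\<phi>\<close> serves as \<open>u\<close>;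
  its projection even equals the image of \<open>w\<close> under \<open>f\<close>.\<close>

lemma is_lift_imp_fundamental_group:
  assumes "is_lift \<phi>" "w \<in> closed_walks G g D d"
  shows "\<exists>u \<in> closed_walks G g C c. homotopic G g E (map_walk f w) (map_walk p u)"
proof
  have w: "is_walk G g D w" "source w = d" "terminal w = d"
    using assms(2) by (auto simp: closed_walks_def)
  then show "map_walk \<phi> w \<in> closed_walks G g C c"
    using assms(1) is_walk_map[OF dom.fractional_BC_axioms cov.fractional_BC_axioms]
    by (auto simp: closed_walks_def is_lift_def)
  have "map_walk f w = map_walk p (map_walk \<phi> w)"
    using map_walk_factor[OF w(1), of f p \<phi>] assms(1) by (simp add: is_lift_def)
  then show "homotopic G g E (map_walk f w) (map_walk p (map_walk \<phi> w))"
    using homotopic.refl[OF f_walk[OF w(1)]] by simp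
qed

text \<open>The graph of the map to be constructed. It is stated as a relation because the terminal
  of the lift may a priori depend on the walk \<open>w\<close>.\<close>

definition lift_rel :: "'b \<Rightarrow> 'c \<Rightarrow> bool"
  where "lift_rel e x \<longleftrightarrow> (\<exists>w a. is_walk G g D w \<and> source w = d \<and> terminal w = e \<and>
    is_walk G g C a \<and> source a = c \<and> terminal a = x \<and> map_walk p a = map_walk f w)"

lemma lift_rel_base: "lift_rel d c"
  unfolding lift_rel_def using d_angle c_angle base_points
  by (intro exI[of _ "Trivial d"] exI[of _ "Trivial c"]) auto

lemma lift_rel_closed: "lift_rel e x \<Longrightarrow> e \<in> angles D \<and> x \<in> angles C \<and> p x = f e"
  unfolding lift_rel_def by (metis is_walk_terminal terminal_map_walk)

text \<open>Both walks are extended by a step of the same kind. With \<open>Fwd\<close> this yields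
  equivariance of \<open>\<phi>\<close>, with \<open>Tau\<close> its compatibility with polygons and
  lines.\<close>

lemma lift_rel_step:
  assumes "lift_rel e x" "e' \<in> angles D" "x' \<in> angles C" "p x' = f e'"
    and "valid_step G g D e' \<delta> e" "valid_step G g C x' \<delta> x"
  shows "lift_rel e' x'"
proof -
  obtain w a where "is_walk G g D w" "source w = d" "terminal w = e"
    "is_walk G g C a" "source a = c" "terminal a = x" "map_walk p a = map_walk f w"
    using assms(1) by (auto simp: lift_rel_def)
  then show ?thesis
    unfolding lift_rel_def using assms
    by (intro exI[of _ "Step e' \<delta> w"] exI[of _ "Step x' \<delta> a"]) auto
qed

lemma lift_rel_total:
  assumes "e \<in> angles D"
  shows "\<exists>x. lift_rel e x"
proof -
  obtain w where w: "is_walk G g D w" "source w = d" "terminal w = e"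
    using dom_connected d_angle assms by (auto simp: fbc_connected_def)
  then obtain a where "is_walk G g C a" "source a = c" "map_walk p a = map_walk f w"
    using lift_walk_exists[of "map_walk f w" c] f_walk c_angle base_points by auto
  with w show ?thesis
    by (auto simp: lift_rel_def)
qed

section \<open>Sufficiency of the condition\<close>

context
  assumes fundamental_group_cond: "\<And>w. w \<in> closed_walks G g D d \<Longrightarrow>
    \<exists>u \<in> closed_walks G g C c. homotopic G g E (map_walk f w) (map_walk p u)"
begin

text \<open>Here the condition on fundamental groups enters. The homotopy from
  \<open>map_walk f w\<close> to the projection of the loop \<open>u\<close> lifts at
  \<open>c\<close>, so \<open>a\<close> ends where \<open>u\<close> does.\<close>

lemma lift_of_closed_walk_closed:
  assumes "w \<in> closed_walks G g D d"
    and "is_walk G g C a" "source a = c" "map_walk p a = map_walk f w"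
  shows "terminal a = c"
proof -
  obtain u where u: "u \<in> closed_walks G g C c" "homotopic G g E (map_walk f w) (map_walk p u)"
    using fundamental_group_cond[OF assms(1)] by blast
  then have "homotopic G g C a u"
    using assms by (intro lift_homotopic[OF u(2)]) (auto simp: closed_walks_def)
  then show ?thesis
    using u(1) cov.homotopic_walks by (auto simp: closed_walks_def)
qed

text \<open>Close \<open>w\<close> and \<open>w'\<close> by one common walk \<open>v\<close> back to
  \<open>d\<close>. The lifts of \<open>v\<close> at \<open>x\<close> and at \<open>y\<close> both
  end at \<open>c\<close>, hence are equal by uniqueness from the terminal, and so are their
  sources.\<close>

lemma lift_rel_unique:
  assumes "lift_rel e x" "lift_rel e y"
  shows "x = y"
proof -
  obtain w a where w: "is_walk G g D w" "source w = d" "terminal w = e"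
    and a: "is_walk G g C a" "source a = c" "terminal a = x" "map_walk p a = map_walk f w"
    using assms(1) by (auto simp: lift_rel_def)
  obtain w' a' where w': "is_walk G g D w'" "source w' = d" "terminal w' = e"
    and a': "is_walk G g C a'" "source a' = c" "terminal a' = y" "map_walk p a' = map_walk f w'"
    using assms(2) by (auto simp: lift_rel_def)
  obtain v where v: "is_walk G g D v" "source v = e" "terminal v = d"
    using dom_connected d_angle lift_rel_closed[OF assms(1)] by (auto simp: fbc_connected_def)
  have fv: "is_walk G g E (map_walk f v)" "source (map_walk f v) = f e"
    using f_walk v by auto
  obtain b where b: "is_walk G g C b" "source b = x" "map_walk p b = map_walk f v"
    using lift_walk_exists[OF fv(1)] fv(2) lift_rel_closed[OF assms(1)] by metis
  obtain b' where b': "is_walk G g C b'" "source b' = y" "map_walk p b' = map_walk f v"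
    using lift_walk_exists[OF fv(1)] fv(2) lift_rel_closed[OF assms(2)] by metis
  have "terminal (b \<cdot> a) = c"
    using v w a b by (intro lift_of_closed_walk_closed[of "v \<cdot> w"]) (auto simp: closed_walks_def is_walk_comp)
  moreover have "terminal (b' \<cdot> a') = c"
    using v w' a' b' by (intro lift_of_closed_walk_closed[of "v \<cdot> w'"]) (auto simp: closed_walks_def is_walk_comp)
  ultimately have "b = b'"
    using a b a' b' by (intro lift_walk_unique_terminal) auto
  then show ?thesis
    using b b' by simp
qed

lemma lift_exists: "\<exists>\<phi>. is_lift \<phi>"
proof -
  define \<phi> where "\<phi> e = (SOME x. lift_rel e x)" for e
  have rel: "lift_rel e (\<phi> e)" if "e \<in> angles D" for e
    unfolding \<phi>_def using lift_rel_total[OF that] by (rule someI_ex)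
  \<comment> \<open>The way to compute \<open>\<phi>\<close> from here on: exhibit a pair of walks
    that reaches \<open>e\<close> and \<open>x\<close>.\<close>
  have eq: "\<phi> e = x" if "lift_rel e x" for e x
    using rel lift_rel_unique lift_rel_closed that by blast
  have closed: "\<phi> e \<in> angles C" "p (\<phi> e) = f e" if "e \<in> angles D" for e
    using rel[OF that] lift_rel_closed by auto
  have gen: "\<phi> (act D g e) = act C g (\<phi> e)" if "e \<in> angles D" for e
    using that closed cov.gen_closed
    by (intro eq lift_rel_step[OF rel[OF that], of _ _ Fwd])
      (auto simp: dom.act_closed cov.act_closed proj_act f_act)
  have act: "\<phi> (act D z e) = act C z (\<phi> e)" if "z \<in> carrier G" "e \<in> angles D" for z e
  proof (rule dom.equivariant_if_generator[where f = \<phi> and E' = C])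
    show "\<phi> \<in> angles D \<rightarrow> angles C"
      using closed(1) by blast
  qed (fact cov.fractional_BC_axioms gen that)+
  note f_blocks = morphism_Pcl[OF dom.fractional_BC_axioms base.fractional_BC_axioms f_morphism]
  have P: "\<phi> h \<in> Pcl C (\<phi> e)" if e: "e \<in> angles D" and "h \<in> Pcl D e" for e h
  proof -
    have h: "h \<in> angles D" "Pcl D h = Pcl D e"
      using that by (auto simp: dom.mem_Pcl_iff)
    then have "Pcl E (f h) = Pcl E (p (\<phi> e))"
      using f_blocks(1)[of h e] e closed(2)[of e] by simp
    \<comment> \<open>The only candidate for \<open>\<phi> h\<close>; a \<open>Tau\<close> step in
      \<open>D\<close> and one in \<open>C\<close> confirm it.\<close>
    then obtain y where y: "y \<in> angles C" "Pcl C y = Pcl C (\<phi> e)" "p y = f h"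
      using lift_Pcl[of "\<phi> e" "f h"] closed(1)[OF e] f_closed[OF h(1)] by blast
    then have "\<phi> h = y"
      using h y by (intro eq lift_rel_step[OF rel[OF e], of _ _ Tau]) auto
    then show ?thesis
      using y closed(1)[OF e] by (simp add: cov.mem_Pcl_iff)
  qed
  have L: "\<phi> h \<in> Lcl C (\<phi> e)" if e: "e \<in> angles D" and "h \<in> Lcl D e" for e h
  proof -
    have h: "h \<in> angles D" "Lcl D h = Lcl D e"
      using that by (auto simp: dom.mem_Lcl_iff)
    then have "Lcl E (f h) = Lcl E (p (\<phi> e))"
      using f_blocks(2)[of h e] e closed(2)[of e] by simp
    then obtain y where y: "y \<in> angles C" "Lcl C y = Lcl C (\<phi> e)" "p y = f h"
      using lift_Lcl[of "\<phi> e" "f h"] closed(1)[OF e] f_closed[OF h(1)] by blast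
    \<comment> \<open>A \<open>Tau\<close> step is a condition on polygons, so equality of lines is
      first weakened on both sides.\<close>
    then have "\<phi> h = y"
      using h y closed(1)[OF e] e cov.Lcl_imp_Pcl[of y "\<phi> e"] dom.Lcl_imp_Pcl[of h e]
      by (intro eq lift_rel_step[OF rel[OF e], of _ _ Tau]) auto
    then show ?thesis
      using y closed(1)[OF e] by (simp add: cov.mem_Lcl_iff)
  qed
  have "deg C (\<phi> e) = deg D e" if "e \<in> angles D" for e
    using that closed[of e] proj_deg[of "\<phi> e"] f_deg[of e] by simp
  then have "is_lift \<phi>"
    using closed act P L eq[OF lift_rel_base] by (auto simp: is_lift_def fbc_morphism_def)
  then show ?thesis
    by blast
qed

end

lemma lift_exists_iff:
  "(\<exists>\<phi>. is_lift \<phi>) \<longleftrightarrow> induced_map G g E f ` carrier (fundamental_group G g D d)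
      \<subseteq> induced_map G g E p ` carrier (fundamental_group G g C c)"
  unfolding fundamental_group_subset_iff
  using is_lift_imp_fundamental_group lift_exists by blast

end

theorem proposition1p1:
  fixes G :: "('g, 'm) monoid_scheme" and g :: 'g
    and E :: "('g, 'a) fbc_data" and E1 :: "('g, 'b) fbc_data" and E2 :: "('g, 'c) fbc_data"
    and f1 :: "'b \<Rightarrow> 'a" and f2 :: "'c \<Rightarrow> 'a" and e1 :: 'b and e2 :: 'c
  assumes "infinite_cyclic_group G g"
    and "fractional_BC G g E" and "fractional_BC G g E1" and "fractional_BC G g E2"
    and "fbc_connected G g E1"
    and "fbc_morphism G E1 E f1" and "fbc_covering G E2 E f2"
    and "e1 \<in> angles E1" and "e2 \<in> angles E2" and "f1 e1 = f2 e2"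
  shows "((\<exists>\<phi>. fbc_morphism G E1 E2 \<phi> \<and> (\<forall>e \<in> angles E1. f1 e = f2 (\<phi> e)) \<and> \<phi> e1 = e2) \<longleftrightarrow>
      induced_map G g E f1 ` carrier (fundamental_group G g E1 e1)
        \<subseteq> induced_map G g E f2 ` carrier (fundamental_group G g E2 e2)) \<and>
    (\<forall>\<phi> \<psi>. fbc_morphism G E1 E2 \<phi> \<and> (\<forall>e \<in> angles E1. f1 e = f2 (\<phi> e)) \<and> \<phi> e1 = e2 \<and>
        fbc_morphism G E1 E2 \<psi> \<and> (\<forall>e \<in> angles E1. f1 e = f2 (\<psi> e)) \<and> \<psi> e1 = e2
      \<longrightarrow> (\<forall>e \<in> angles E1. \<phi> e = \<psi> e))"
proof -
  interpret E2: fractional_BC G g E2 by fact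
  interpret E: fractional_BC G g E by fact
  interpret E1: fractional_BC G g E1 by fact
  interpret fbc_lifting G g E2 E f2 E1 f1 e1 e2
    using assms by unfold_locales auto
  show ?thesis
    using lift_exists_iff lift_unique unfolding is_lift_def by blast
qed

end
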